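(* For every positive integer $n$ with $\omega(n)\ge 2$, the chromatic number of $\tilde{\Gamma}_{\mathcal{H}}(\mathbb{Z}_n)$ is $\chi(\tilde{\Gamma}_{\mathcal{H}}(\mathbb{Z}_n))=2$.
   Context: $\omega(n)$ denotes the number of distinct prime divisors of $n$. A hypergraph is a pair $(V,E)$ with $E$ a set of subsets of $V$ (hyperedges). For a group $G$ with identity $e$, let $S$ be the set of all non-trivial proper subgroups of $G$. The intersection hypergraph $\tilde{\Gamma}_{\mathcal{H}}(G)$ has vertex set $V=\{H\in S : H\cap K=\{e\}\text{ for some }K\in S\}$, and $E\subseteq V$ is a hyperedge if and only if (1) for distinct $H,K\in E$, $H\cap K=\{e\}$; and (2) there is no $E'\subseteq V$ with $E'\supsetneq E$ satisfying (1). A proper vertex-coloring of a hypergraph is an assignment of colors to its vertices such that no hyperedge has all its vertices of the same color. The chromatic number $\chi$ is the minimum number of colors needed for a proper vertex-coloring. *)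

theory Defs
  imports
    "HOL-Algebra.Elementary_Groups"
    "HOL-Computational_Algebra.Primes"
    "HOL-Library.Extended_Nat"
begin

definition omega :: "nat \<Rightarrow> nat" where
  "omega n = card {p. prime p \<and> p dvd n}"

type_synonym 'v hypergraph = "'v set \<times> 'v set set"

abbreviation vertices :: "'v hypergraph \<Rightarrow> 'v set" where
  "vertices \<equiv> fst"

abbreviation hyperedges :: "'v hypergraph \<Rightarrow> 'v set set" where
  "hyperedges \<equiv> snd"

definition proper_coloring :: "'v hypergraph \<Rightarrow> 'c set \<Rightarrow> ('v \<Rightarrow> 'c) \<Rightarrow> bool" where
  "proper_coloring X C f \<longleftrightarrow>
     f \<in> vertices X \<rightarrow> C \<and>
     (\<forall>E \<in> hyperedges X. \<not> (\<exists>c. \<forall>v \<in> E. f v = c))"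

text \<open>The value is \<open>\<infinity>\<close> if no finite number of colors suffices (the infimum of the empty set).\<close>

definition chromatic_number :: "'v hypergraph \<Rightarrow> enat" where
  "chromatic_number X = Inf {enat k | k. \<exists>f. proper_coloring X {..<k} f}"

definition nontrivial_proper_subgroups :: "('a, 'b) monoid_scheme \<Rightarrow> 'a set set" where
  "nontrivial_proper_subgroups G = {H. subgroup H G \<and> H \<noteq> {\<one>\<^bsub>G\<^esub>} \<and> H \<noteq> carrier G}"

definition intersection_vertices :: "('a, 'b) monoid_scheme \<Rightarrow> 'a set set" where
  "intersection_vertices G =
     {H \<in> nontrivial_proper_subgroups G.
        \<exists>K \<in> nontrivial_proper_subgroups G. H \<inter> K = {\<one>\<^bsub>G\<^esub>}}"

definition pairwise_trivial_intersection ::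
    "('a, 'b) monoid_scheme \<Rightarrow> 'a set set \<Rightarrow> bool" where
  "pairwise_trivial_intersection G E \<longleftrightarrow>
     (\<forall>H \<in> E. \<forall>K \<in> E. H \<noteq> K \<longrightarrow> H \<inter> K = {\<one>\<^bsub>G\<^esub>})"

definition intersection_hypergraph :: "('a, 'b) monoid_scheme \<Rightarrow> 'a set hypergraph" where
  "intersection_hypergraph G =
     (intersection_vertices G,
      {E. E \<subseteq> intersection_vertices G \<and> pairwise_trivial_intersection G E \<and>
          \<not> (\<exists>E'. E' \<subseteq> intersection_vertices G \<and> E \<subset> E' \<and>
                  pairwise_trivial_intersection G E')})"

end

theory Submission
  imports Defs "HOL-Algebra.Sylow"
begin

text \<open>In a finite group with a vertex, take a minimal non-trivial subgroup \<open>P\<close> below one end of a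
  trivially intersecting pair, and color a subgroup by whether it contains \<open>P\<close>. Two distinct members
  of a hyperedge cannot both contain \<open>P\<close>, and a single vertex is never maximal; while if no member
  contains \<open>P\<close>, then by minimality of \<open>P\<close> the family can be enlarged by \<open>P\<close>. For \<open>\<int>\<^sub>n\<close>, subgroups of
  distinct prime orders provide a vertex.\<close>

text \<open>By Lagrange, applied inside each of the two subgroups, the order of the intersection
  divides both coprime orders.\<close>

lemma (in group) subgroups_coprime_card_Int:
  assumes "subgroup H G" "subgroup K G" "coprime (card H) (card K)"
  shows "H \<inter> K = {\<one>}"
proof -
  have "card (H \<inter> K) dvd card J" if "subgroup J G" "H \<inter> K \<subseteq> J" for J
  proof -
    interpret J: group "G\<lparr>carrier := J\<rparr>"
      using subgroup.subgroup_is_group[OF that(1)] is_group by blast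
    have "subgroup (H \<inter> K) (G\<lparr>carrier := J\<rparr>)"
      using subgroup_incl[OF subgroups_Inter_pair[OF assms(1,2)] that] .
    from J.lagrange[OF this] show ?thesis
      by (simp add: order_def) (metis dvd_triv_right)
  qed
  then have "card (H \<inter> K) dvd card H" "card (H \<inter> K) dvd card K"
    using assms by auto
  then have "card (H \<inter> K) = 1"
    using assms(3) coprime_common_divisor_nat by blast
  moreover have "\<one> \<in> H \<inter> K"
    using assms subgroup.one_closed by blast
  ultimately show ?thesis
    by (metis card_1_singletonE singletonD)
qed

text \<open>Take \<open>P\<close> minimal under inclusion among the non-trivial subgroups inside
  \<open>H\<close>. Since \<open>K \<inter> P\<close> is a subgroup inside \<open>P\<close>,
  minimality makes it trivial or all of \<open>P\<close>.\<close>

lemma (in group) ex_minimal_subgroup: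
  assumes "subgroup H G" "H \<noteq> {\<one>}" "finite H"
  obtains P where "subgroup P G" "P \<noteq> {\<one>}" "P \<subseteq> H"
    "\<And>K. subgroup K G \<Longrightarrow> K \<inter> P = {\<one>} \<or> P \<subseteq> K"
proof -
  let ?A = "{K. subgroup K G \<and> K \<noteq> {\<one>} \<and> K \<subseteq> H}"
  have "finite ?A" "H \<in> ?A"
    using assms by (auto intro: finite_subset[of _ "Pow H"])
  from finite_has_minimal2[OF this]
  obtain P where P: "P \<in> ?A" and min: "\<forall>K\<in>?A. K \<subseteq> P \<longrightarrow> P = K"
    by (elim bexE conjE)
  have "K \<inter> P = {\<one>} \<or> P \<subseteq> K" if K: "subgroup K G" for K
  proof (rule disjCI)
    assume "\<not> P \<subseteq> K"
    then have "K \<inter> P \<notin> ?A"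
      using min by auto
    moreover have "subgroup (K \<inter> P) G"
      using subgroups_Inter_pair K P by simp
    ultimately show "K \<inter> P = {\<one>}"
      using P by auto
  qed
  with P show ?thesis
    by (intro that[of P]) simp_all
qed

lemma (in group) finite_intersection_vertices:
  assumes "finite (carrier G)"
  shows "finite (intersection_vertices G)"
proof (rule finite_subset)
  show "intersection_vertices G \<subseteq> Pow (carrier G)"
    using subgroup.subset
    by (auto simp: intersection_vertices_def nontrivial_proper_subgroups_def)
qed (use assms in simp)

text \<open>Serves the lower bound: one color fails only if there is a hyperedge to violate. The
  empty family starts the search for a maximal one.\<close>

lemma ex_hyperedge:
  assumes "finite (intersection_vertices G)"
  shows "\<exists>E. E \<in> hyperedges (intersection_hypergraph G)"
proof -
  let ?A = "{E. E \<subseteq> intersection_vertices G \<and> pairwise_trivial_intersection G E}"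
  have "finite ?A" "{} \<in> ?A"
    using assms by (auto simp: pairwise_trivial_intersection_def)
  from finite_has_maximal2[OF this]
  obtain E where "E \<in> ?A" "\<forall>E'\<in>?A. E \<subseteq> E' \<longrightarrow> E = E'"
    by (elim bexE conjE)
  then show ?thesis
    by (auto simp: intersection_hypergraph_def)
qed

lemma hyperedge_maximal:
  assumes "E \<in> hyperedges (intersection_hypergraph G)" "H \<in> intersection_vertices G"
    and "\<And>K. K \<in> E \<Longrightarrow> K \<inter> H = {\<one>\<^bsub>G\<^esub>}"
  shows "H \<in> E"
proof (rule ccontr)
  assume "H \<notin> E"
  moreover have "pairwise_trivial_intersection G (insert H E)"
    using assms by (auto simp: intersection_hypergraph_def pairwise_trivial_intersection_def)
  ultimately show False
    using assms(1,2) by (auto simp: intersection_hypergraph_def)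
qed

lemma (in group) ex_two_coloring:
  assumes "finite (carrier G)" "intersection_vertices G \<noteq> {}"
  shows "\<exists>f. proper_coloring (intersection_hypergraph G) {..<2::nat} f"
proof -
  obtain H K where HK: "H \<in> nontrivial_proper_subgroups G" "K \<in> nontrivial_proper_subgroups G"
    "H \<inter> K = {\<one>}"
    using assms(2) by (auto simp: intersection_vertices_def)
  then have H: "subgroup H G" "H \<noteq> {\<one>}" "finite H"
    using subgroup.subset finite_subset[OF _ assms(1)]
    by (auto simp: nontrivial_proper_subgroups_def)
  obtain P where P: "subgroup P G" "P \<noteq> {\<one>}" "P \<subseteq> H"
    and min: "\<And>K. subgroup K G \<Longrightarrow> K \<inter> P = {\<one>} \<or> P \<subseteq> K"
    using ex_minimal_subgroup[OF H] by blast
  have "P \<noteq> carrier G"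
    using HK(1) P(3) subgroup.subset[OF H(1)] by (auto simp: nontrivial_proper_subgroups_def)
  moreover have "P \<inter> K = {\<one>}"
    using HK(3) P(3) subgroup.one_closed[OF P(1)] by blast
  ultimately have PV: "P \<in> intersection_vertices G"
    using P HK(2) by (auto simp: intersection_vertices_def nontrivial_proper_subgroups_def)
  have one_P: "\<one> \<in> P"
    using P(1) subgroup.one_closed by blast
  define f :: "'a set \<Rightarrow> nat" where "f H = (if P \<subseteq> H then 1 else 0)" for H
  have False if E: "E \<in> hyperedges (intersection_hypergraph G)" and c: "\<forall>H\<in>E. f H = c" for E c
  proof (cases "\<exists>H\<in>E. P \<subseteq> H")
    case True
    then obtain H where H: "H \<in> E" "P \<subseteq> H"
      by blast
    have "P \<subseteq> K" if "K \<in> E" for K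
      using c H that by (metis f_def zero_neq_one)
    then have "P \<subseteq> H \<inter> K" if "K \<in> E" for K
      using H that by blast
    moreover have "H \<inter> K = {\<one>}" if "K \<in> E" "K \<noteq> H" for K
      using E H that
      by (simp add: intersection_hypergraph_def pairwise_trivial_intersection_def)
    \<comment> \<open>A second member would contain \<open>P\<close> and yet meet \<open>H\<close>
      trivially.\<close>
    ultimately have EH: "E = {H}"
      using H(1) P(2) one_P by blast
    have HV: "H \<in> intersection_vertices G"
      using E EH by (auto simp: intersection_hypergraph_def)
    \<comment> \<open>The partner \<open>K\<close> of \<open>H\<close> is itself a vertex, witnessed
      by \<open>H\<close>. Maximality of \<open>{H}\<close> then forces \<open>K = H\<close>, so
      \<open>H\<close> would be trivial although it contains \<open>P\<close>.\<close>
    then obtain K where "K \<in> intersection_vertices G" "H \<inter> K = {\<one>}"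
      by (auto simp: intersection_vertices_def Int_commute)
    then show False
      using hyperedge_maximal[OF E, of K] EH H P(2) one_P by auto
  next
    case False
    moreover have "subgroup H G" if "H \<in> E" for H
      using E that by (auto simp: intersection_hypergraph_def intersection_vertices_def
          nontrivial_proper_subgroups_def)
    \<comment> \<open>By the dichotomy for \<open>P\<close>, every member meets \<open>P\<close>
      trivially; this also covers an empty \<open>E\<close>.\<close>
    ultimately have "P \<in> E"
      using hyperedge_maximal[OF E PV] min by blast
    with False show False
      by blast
  qed
  moreover have "f H < 2" for H
    by (simp add: f_def)
  ultimately have "proper_coloring (intersection_hypergraph G) {..<2} f"
    unfolding proper_coloring_def by blast
  then show ?thesis
    by blast
qed

theorem (in group) chromatic_number_intersection_hypergraph:
  assumes "finite (carrier G)" "intersection_vertices G \<noteq> {}"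
  shows "chromatic_number (intersection_hypergraph G) = 2"
proof -
  have "2 \<le> k" if f: "proper_coloring (intersection_hypergraph G) {..<k} f" for k :: nat and f
  proof (rule ccontr)
    assume "\<not> 2 \<le> k"
    obtain E where E: "E \<in> hyperedges (intersection_hypergraph G)"
      using ex_hyperedge finite_intersection_vertices assms(1) by blast
    \<comment> \<open>With fewer than two colors, 0 is the only possible value, so \<open>E\<close>
      is monochromatic.\<close>
    have "f v = 0" if "v \<in> E" for v
    proof -
      have "v \<in> vertices (intersection_hypergraph G)"
        using E that by (auto simp: intersection_hypergraph_def)
      then have "f v < k"
        using f by (auto simp: proper_coloring_def)
      with \<open>\<not> 2 \<le> k\<close> show ?thesis
        by linarith
    qed
    with E f show False
      by (metis proper_coloring_def)
  qed
  then have "2 \<le> chromatic_number (intersection_hypergraph G)"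
    by (auto simp: chromatic_number_def numeral_eq_enat intro!: Inf_greatest)
  moreover have "chromatic_number (intersection_hypergraph G) \<le> 2"
    using ex_two_coloring[OF assms]
    by (auto simp: chromatic_number_def numeral_eq_enat intro!: Inf_lower)
  ultimately show ?thesis
    by order
qed

lemma (in group) intersection_vertices_nonempty:
  assumes "finite (carrier G)" "prime p" "prime q" "p \<noteq> q" "p dvd order G" "q dvd order G"
  shows "intersection_vertices G \<noteq> {}"
proof -
  \<comment> \<open>Cauchy's theorem, as Sylow with exponent 1: the cofactor may still be divisible
    by \<open>r\<close>.\<close>
  have *: "\<exists>H. subgroup H G \<and> card H = r" if "prime r" "r dvd order G" for r
    using sylow_thm[of r G 1] that assms(1) is_group by (auto simp: dvd_def)
  obtain H K where H: "subgroup H G" "card H = p" and K: "subgroup K G" "card K = q"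
    using * assms by meson
  have "H \<inter> K = {\<one>}"
    using subgroups_coprime_card_Int H K assms primes_coprime by blast
  \<comment> \<open>Otherwise one of the primes would divide the other. This makes \<open>H\<close>
    and \<open>K\<close> proper.\<close>
  moreover have "order G \<noteq> p" "order G \<noteq> q"
    using assms primes_dvd_imp_eq by blast+
  ultimately have "H \<in> intersection_vertices G"
    using H K assms(2,3)
    by (auto simp: intersection_vertices_def nontrivial_proper_subgroups_def order_def)
  then show ?thesis
    by blast
qed

theorem theorem3p11:
  fixes n :: nat
  assumes "n > 0" and "omega n \<ge> 2"
  shows "chromatic_number (intersection_hypergraph (integer_mod_group n)) = 2"
proof -
  interpret group "integer_mod_group n"
    by simp
  \<comment> \<open>Positivity matters: \<open>integer_mod_group 0\<close> is the infinite group of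
    integers.\<close>
  have carrier: "carrier (integer_mod_group n) = {0..<int n}"
    using assms(1) by (simp add: carrier_integer_mod_group)
  then have order: "order (integer_mod_group n) = n"
    by (simp add: order_def)
  obtain p q where "prime p" "prime q" "p dvd n" "q dvd n" "p \<noteq> q"
  proof -
    \<comment> \<open>A non-empty set that is not a singleton has two distinct elements, so no
      separate finiteness argument is made.\<close>
    have "card {p. prime p \<and> p dvd n} \<noteq> 0" "card {p. prime p \<and> p dvd n} \<noteq> 1"
      using assms(2) by (simp_all add: omega_def)
    then have "\<not> is_singleton {p. prime p \<and> p dvd n}" "{p. prime p \<and> p dvd n} \<noteq> {}"
      by (metis is_singleton_altdef, metis card.empty)
    with that show ?thesis
      by (metis (mono_tags, lifting) Collect_empty_eq is_singletonI' mem_Collect_eq)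
  qed
  then have "intersection_vertices (integer_mod_group n) \<noteq> {}"
    using intersection_vertices_nonempty[of p q] carrier order by simp
  then show ?thesis
    using chromatic_number_intersection_hypergraph carrier by simp
qed

end
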